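(* Let $n\ge1$. For every alternating sign triangle $A$ of size $n$, the identity triangle of size $n$ can be obtained from $A$ by a finite sequence of operations, each of which adds to the current array one of the sub-triangle patterns $P_1^{(r,c)},P_2^{(r,c)},P_3^{(r,c)}$ (for some admissible position $(r,c)$) defined in the context.
   Context: Fix an integer $n\ge 1$. Let $V_n=\{(i,j)\in\mathbb{Z}^2 : |i|+|j|\le n,\ j\le 0,\ i+j\equiv n \pmod 2\}$. Two points of $V_n$ are joined by a lattice edge if they differ by $(\pm 2,0)$ or by $(\pm1,\pm1)$. A simplified grove of size $n$ is a graph $G$ with vertex set $V_n$ whose edges are lattice edges, such that (acyclicity) $G$ has no cycle, and (connectivity) each connected component of $G$ contains exactly one of the following sets of boundary vertices and each of these sets is contained in some component: the singletons $\{(-n,0)\},\{(n,0)\},\{(0,-n)\}$; the west pairs $\{(-i,0),(\frac{-n-i}{2},\frac{-n+i}{2})\}$ for $0<i<n$, $i\equiv n \pmod 2$; the east pairs $\{(i,0),(\frac{n+i}{2},\frac{-n+i}{2})\}$ for $0<i<n$, $i\equiv n\pmod 2$; the south pairs $\{(-n+i,-i),(n-i,-i)\}$ for $\frac n2<i<n$; and, if $n$ is even, the middle triplet $\{(0,0),(-\frac n2,-\frac n2),(\frac n2,-\frac n2)\}$. For $1\le r\le n$ and $1\le c\le n+1-r$ put $a_{r,c}=2c-2-n+r$ and let $T_{r,c}$ be the (downward) unit triangle with vertices $(a_{r,c},-r)$, $(a_{r,c}-1,-r+1)$, $(a_{r,c}+1,-r+1)$; its three sides are lattice edges. For a simplified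 grove $G$ of size $n$, define the triangular array $A_G$ with entries $A_G(r,c)=1-e_{r,c}$, where $e_{r,c}$ is the number of sides of $T_{r,c}$ that are edges of $G$. An alternating sign triangle of size $n$ is an array of the form $A_G$ for some simplified grove $G$ of size $n$. (Row $r$ has $n+1-r$ entries; entry $(r+1,c)$ is drawn below and between entries $(r,c)$ and $(r,c+1)$.) The identity triangle of size $n$ is the triangular array with entries $I(r,c)=1$ if $c=r$ and $I(r,c)=0$ otherwise ($1\le r\le n$, $1\le c\le n+1-r$); i.e. its $r$-th row has a single $1$ in position $r$ when $r\le n+1-r$, and all other entries are $0$. For $1\le r\le n-1$ and $1\le c\le n-r$, the sub-triangle patterns at position $(r,c)$ are the arrays supported on the entries $(r,c),(r,c+1),(r+1,c)$ given by: $P_1^{(r,c)}$: $-1$ at $(r,c)$, $1$ at $(r,c+1)$, $0$ at $(r+1,c)$; $P_2^{(r,c)}$: $1$ at $(r,c)$, $0$ at $(r,c+1)$, $-1$ at $(r+1,c)$; $P_3^{(r,c)}$: $0$ at $(r,c)$, $-1$ at $(r,c+1)$, $1$ at $(r+1,c)$ (and $0$ at all other entries). Adding a pattern means entrywise addition. *)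

theory Defs
  imports Main
begin

type_synonym point = "int \<times> int"

definition grove_verts :: "nat \<Rightarrow> point set" where
  "grove_verts n = {(i, j). \<bar>i\<bar> + \<bar>j\<bar> \<le> int n \<and> j \<le> 0 \<and> (i + j) mod 2 = int n mod 2}"

definition lattice_edges :: "nat \<Rightarrow> point set set" where
  "lattice_edges n = {{p, q} | p q. p \<in> grove_verts n \<and> q \<in> grove_verts n \<and>
     (fst q - fst p, snd q - snd p) \<in> {(2, 0), (-2, 0), (1, 1), (1, -1), (-1, 1), (-1, -1)}}"

text \<open>A graph on a fixed vertex set is given by its edge set, each edge being a two-element set.\<close>

definition adj_rel :: "'v set set \<Rightarrow> ('v \<times> 'v) set" where
  "adj_rel E = {(u, v). {u, v} \<in> E}"

definition is_cycle :: "'v set set \<Rightarrow> 'v list \<Rightarrow> bool" where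
  "is_cycle E vs \<longleftrightarrow> 3 \<le> length vs \<and> distinct vs \<and>
     (\<forall>k. Suc k < length vs \<longrightarrow> {vs ! k, vs ! Suc k} \<in> E) \<and> {last vs, hd vs} \<in> E"

definition graph_components :: "'v set \<Rightarrow> 'v set set \<Rightarrow> 'v set set" where
  "graph_components V E = V // {(u, v). u \<in> V \<and> v \<in> V \<and> (u, v) \<in> (adj_rel E)\<^sup>*}"

definition corner_sets :: "nat \<Rightarrow> point set set" where
  "corner_sets n = {{(- int n, 0)}, {(int n, 0)}, {(0, - int n)}}"

definition west_pairs :: "nat \<Rightarrow> point set set" where
  "west_pairs n = {{(- i, 0), ((- int n - i) div 2, (- int n + i) div 2)} | i.
     0 < i \<and> i < int n \<and> i mod 2 = int n mod 2}"

definition east_pairs :: "nat \<Rightarrow> point set set" where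
  "east_pairs n = {{(i, 0), ((int n + i) div 2, (- int n + i) div 2)} | i.
     0 < i \<and> i < int n \<and> i mod 2 = int n mod 2}"

definition south_pairs :: "nat \<Rightarrow> point set set" where
  "south_pairs n = {{(- int n + i, - i), (int n - i, - i)} | i. int n < 2 * i \<and> i < int n}"

definition middle_triplet :: "nat \<Rightarrow> point set set" where
  "middle_triplet n =
     (if even n then {{(0, 0), (- (int n div 2), - (int n div 2)), (int n div 2, - (int n div 2))}}
      else {})"

definition boundary_sets :: "nat \<Rightarrow> point set set" where
  "boundary_sets n =
     corner_sets n \<union> west_pairs n \<union> east_pairs n \<union> south_pairs n \<union> middle_triplet n"

definition simplified_grove :: "nat \<Rightarrow> point set set \<Rightarrow> bool" where
  "simplified_grove n E \<longleftrightarrow>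
     E \<subseteq> lattice_edges n \<and>
     (\<nexists>vs. is_cycle E vs) \<and>
     (\<forall>C \<in> graph_components (grove_verts n) E. \<exists>!S. S \<in> boundary_sets n \<and> S \<subseteq> C) \<and>
     (\<forall>S \<in> boundary_sets n. \<exists>C \<in> graph_components (grove_verts n) E. S \<subseteq> C)"

text \<open>A triangular array of size \<open>n\<close> is a function of row and column that is extended by \<open>0\<close>
  outside the index set below, so that equality of arrays is equality of functions.\<close>

type_synonym tri_array = "nat \<Rightarrow> nat \<Rightarrow> int"

definition tri_index :: "nat \<Rightarrow> (nat \<times> nat) set" where
  "tri_index n = {(r, c). 1 \<le> r \<and> r \<le> n \<and> 1 \<le> c \<and> c \<le> n + 1 - r}"

definition triangle_sides :: "nat \<Rightarrow> nat \<Rightarrow> nat \<Rightarrow> point set set" where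
  "triangle_sides n r c =
     (let a = 2 * int c - 2 - int n + int r;
          x = (a, - int r); y = (a - 1, - int r + 1); z = (a + 1, - int r + 1)
      in {{x, y}, {x, z}, {y, z}})"

definition grove_array :: "nat \<Rightarrow> point set set \<Rightarrow> tri_array" where
  "grove_array n E = (\<lambda>r c. if (r, c) \<in> tri_index n
     then 1 - int (card (triangle_sides n r c \<inter> E)) else 0)"

definition alternating_sign_triangle :: "nat \<Rightarrow> tri_array \<Rightarrow> bool" where
  "alternating_sign_triangle n A \<longleftrightarrow> (\<exists>E. simplified_grove n E \<and> A = grove_array n E)"

definition identity_triangle :: "nat \<Rightarrow> tri_array" where
  "identity_triangle n = (\<lambda>r c. if (r, c) \<in> tri_index n \<and> c = r then 1 else 0)"

text \<open>The array supported on \<open>(r, c)\<close>, \<open>(r, c + 1)\<close>, \<open>(r + 1, c)\<close> with the values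
  \<open>x\<close>, \<open>y\<close>, \<open>z\<close> there, in this order.\<close>

definition sub_triangle :: "int \<Rightarrow> int \<Rightarrow> int \<Rightarrow> nat \<Rightarrow> nat \<Rightarrow> tri_array" where
  "sub_triangle x y z r c = (\<lambda>r' c'.
     if (r', c') = (r, c) then x
     else if (r', c') = (r, c + 1) then y
     else if (r', c') = (r + 1, c) then z
     else 0)"

definition pattern1 :: "nat \<Rightarrow> nat \<Rightarrow> tri_array" where
  "pattern1 = sub_triangle (-1) 1 0"

definition pattern2 :: "nat \<Rightarrow> nat \<Rightarrow> tri_array" where
  "pattern2 = sub_triangle 1 0 (-1)"

definition pattern3 :: "nat \<Rightarrow> nat \<Rightarrow> tri_array" where
  "pattern3 = sub_triangle 0 (-1) 1"

definition pattern_step :: "nat \<Rightarrow> tri_array \<Rightarrow> tri_array \<Rightarrow> bool" where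
  "pattern_step n A B \<longleftrightarrow>
     (\<exists>r c P. 1 \<le> r \<and> r \<le> n - 1 \<and> 1 \<le> c \<and> c \<le> n - r \<and>
        P \<in> {pattern1 r c, pattern2 r c, pattern3 r c} \<and>
        B = (\<lambda>r' c'. A r' c' + P r' c'))"

end

theory Submission
  imports Defs
begin

text \<open>At each position the three patterns add up to zero, so the negative of a pattern is the sum of
  the other two, and the patterns generate as a group all differences of neighbouring unit arrays,
  hence all arrays with entry sum zero. It remains to see that every alternating sign triangle has
  the same entry sum as the identity triangle, namely \<open>(n + 1) div 2\<close>. Each lattice edge is a side
  of exactly one downward triangle, so the entry sum is the number of these triangles minus the
  number of edges of the grove. A grove is a forest, so this is the number of components, which is
  the number of boundary sets, minus the difference \<open>n + 1\<close> of the numbers of vertices and of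
  triangles.\<close>

section \<open>Counting the edges of a forest\<close>

lemma adj_rel_insert: "adj_rel (insert {u, v} E) = insert (u, v) (insert (v, u) (adj_rel E))"
  by (auto simp: adj_rel_def doubleton_eq_iff)

lemma sym_adj_rel: "sym (adj_rel E)"
  by (auto simp: sym_def adj_rel_def insert_commute)

lemma adj_rel_rtrancl_sym: "(x, y) \<in> (adj_rel E)\<^sup>* \<longleftrightarrow> (y, x) \<in> (adj_rel E)\<^sup>*"
  using sym_rtrancl[OF sym_adj_rel[of E]] by (auto dest: symD)

lemma adj_rel_insert_rtrancl_iff:
  "(x, y) \<in> (adj_rel (insert {u, v} E))\<^sup>* \<longleftrightarrow> (x, y) \<in> (adj_rel E)\<^sup>* \<or>
     ((x, u) \<in> (adj_rel E)\<^sup>* \<or> (x, v) \<in> (adj_rel E)\<^sup>*) \<and>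
     ((y, u) \<in> (adj_rel E)\<^sup>* \<or> (y, v) \<in> (adj_rel E)\<^sup>*)"
  unfolding adj_rel_insert rtrancl_insert
  using adj_rel_rtrancl_sym[of u y E] adj_rel_rtrancl_sym[of v y E] by auto

lemma adj_rel_rtrancl_simple_path:
  assumes "(u, v) \<in> (adj_rel E)\<^sup>*"
  obtains vs where "vs \<noteq> []" "hd vs = u" "last vs = v" "distinct vs"
    "successively (\<lambda>x y. {x, y} \<in> E) vs"
proof -
  have "\<exists>vs. vs \<noteq> [] \<and> hd vs = u \<and> last vs = v \<and> distinct vs \<and>
    successively (\<lambda>x y. {x, y} \<in> E) vs"
    using assms
  proof (induction rule: rtrancl_induct)
    case base
    show ?case by (rule exI[of _ "[u]"]) simp
  next
    case (step y z)
    then obtain vs where vs: "vs \<noteq> []" "hd vs = u" "last vs = y" "distinct vs"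
      "successively (\<lambda>x y. {x, y} \<in> E) vs" by blast
    show ?case
    proof (cases "z \<in> set vs")
      case True
      then obtain as bs where "vs = as @ z # bs" by (auto simp: in_set_conv_decomp)
      with vs show ?thesis
        by (intro exI[of _ "as @ [z]"]) (auto simp: successively_append_iff hd_append)
    next
      case False
      with vs step(2) show ?thesis
        by (intro exI[of _ "vs @ [z]"]) (auto simp: successively_append_iff adj_rel_def)
    qed
  qed
  with that show thesis by blast
qed

lemma acyclic_insert_not_connected:
  assumes "\<nexists>vs. is_cycle (insert {u, v} E) vs" "{u, v} \<notin> E" "u \<noteq> v"
  shows "(u, v) \<notin> (adj_rel E)\<^sup>*"
proof
  assume "(u, v) \<in> (adj_rel E)\<^sup>*"
  then obtain vs where vs: "vs \<noteq> []" "hd vs = u" "last vs = v" "distinct vs"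
    and succ: "successively (\<lambda>x y. {x, y} \<in> E) vs"
    by (rule adj_rel_rtrancl_simple_path)
  have "3 \<le> length vs"
  proof (rule ccontr)
    assume "\<not> 3 \<le> length vs"
    with vs(1) consider a where "vs = [a]" | a b where "vs = [a, b]"
      by (cases vs; cases "tl vs"; cases "tl (tl vs)") auto
    then show False using vs succ assms(2,3) by cases auto
  qed
  with vs succ have "is_cycle (insert {u, v} E) vs"
    by (auto simp: is_cycle_def successively_conv_nth insert_commute)
  with assms(1) show False by blast
qed

lemma graph_components_eq_image:
  "graph_components V E = (\<lambda>x. {y \<in> V. (x, y) \<in> (adj_rel E)\<^sup>*}) ` V"
  by (auto simp: graph_components_def quotient_def)

lemma card_graph_components_insert:
  assumes "finite V" "u \<in> V" "v \<in> V" "(u, v) \<notin> (adj_rel E)\<^sup>*"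
  shows "card (graph_components V E) = Suc (card (graph_components V (insert {u, v} E)))"
proof -
  define C where "C x = {y \<in> V. (x, y) \<in> (adj_rel E)\<^sup>*}" for x
  define C' where "C' x = {y \<in> V. (x, y) \<in> (adj_rel (insert {u, v} E))\<^sup>*}" for x
  have comps: "graph_components V E = C ` V" "graph_components V (insert {u, v} E) = C' ` V"
    unfolding graph_components_eq_image C_def C'_def by simp_all
  have C_eq: "C x = C y" if "y \<in> C x" for x y
  proof -
    from that have xy: "(x, y) \<in> (adj_rel E)\<^sup>*" by (simp add: C_def)
    have yx: "(y, x) \<in> (adj_rel E)\<^sup>*" by (subst adj_rel_rtrancl_sym) (rule xy)
    show ?thesis
      unfolding C_def using rtrancl_trans[OF xy] rtrancl_trans[OF yx] by blast
  qed
  have C': "C' x = (if u \<in> C x \<or> v \<in> C x then C x \<union> C u \<union> C v else C x)" for x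
  proof -
    have "(y, u) \<in> (adj_rel E)\<^sup>* \<longleftrightarrow> (u, y) \<in> (adj_rel E)\<^sup>*"
      "(y, v) \<in> (adj_rel E)\<^sup>* \<longleftrightarrow> (v, y) \<in> (adj_rel E)\<^sup>*" for y
      by (rule adj_rel_rtrancl_sym)+
    then show ?thesis
      using assms(2,3) unfolding C_def C'_def adj_rel_insert_rtrancl_iff by auto
  qed
  have C_sym: "x \<in> C y \<longleftrightarrow> y \<in> C x" if "x \<in> V" "y \<in> V" for x y
    using that adj_rel_rtrancl_sym[of x y E] by (simp add: C_def)
  have self: "x \<in> C x" if "x \<in> V" for x
    using that by (simp add: C_def)
  have C'_merged: "C' x = C u \<union> C v" if "x \<in> C u \<union> C v" for x
  proof -
    from that have "C x = C u \<or> C x = C v" using C_eq by blast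
    with self[OF assms(2)] self[OF assms(3)] show ?thesis unfolding C'[of x] by auto
  qed
  have C'_other: "C' x = C x" if "x \<in> V" "x \<notin> C u \<union> C v" for x
    using that C_sym[of u x] C_sym[of v x] assms(2,3) unfolding C'[of x] by simp
  define D where "D = C ` (V - (C u \<union> C v))"
  have "C ` V = insert (C u) (insert (C v) D)"
  proof -
    have "C x \<in> insert (C u) (insert (C v) D)" if "x \<in> V" for x
    proof (cases "x \<in> C u \<union> C v")
      case True
      then have "C x = C u \<or> C x = C v" using C_eq by blast
      then show ?thesis by auto
    next
      case False
      with that show ?thesis by (simp add: D_def)
    qed
    then show ?thesis using assms(2,3) by (auto simp: D_def)
  qed
  moreover have "C' ` V = insert (C u \<union> C v) D"
  proof -
    have "C' x \<in> insert (C u \<union> C v) D" if "x \<in> V" for x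
      using that C'_merged[of x] C'_other[of x] by (cases "x \<in> C u \<union> C v") (simp_all add: D_def)
    moreover have "C' u = C u \<union> C v"
      using C'_merged self assms(2) by blast
    then have "C u \<union> C v \<in> C' ` V" using assms(2) by (metis imageI)
    moreover have "D \<subseteq> C' ` V"
    proof
      fix X assume "X \<in> D"
      then obtain x where "x \<in> V" "x \<notin> C u \<union> C v" "X = C x" by (auto simp: D_def)
      then show "X \<in> C' ` V" using C'_other by (metis imageI)
    qed
    ultimately show ?thesis by auto
  qed
  moreover have "C u \<noteq> C v"
    using self[OF assms(3)] assms(4) by (auto simp: C_def)
  moreover have "C u \<notin> D" "C v \<notin> D" "C u \<union> C v \<notin> D"
    unfolding D_def using self by blast+
  moreover have "finite D" using assms(1) by (simp add: D_def)
  ultimately show ?thesis by (simp add: comps)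
qed

lemma card_forest:
  assumes "finite E" "finite V" "\<nexists>vs. is_cycle E vs"
    and "\<And>e. e \<in> E \<Longrightarrow> \<exists>u v. e = {u, v} \<and> u \<noteq> v \<and> u \<in> V \<and> v \<in> V"
  shows "card E + card (graph_components V E) = card V"
  using assms(1,3,4)
proof (induction E rule: finite_induct)
  case empty
  have "adj_rel ({} :: 'a set set) = {}" by (simp add: adj_rel_def)
  then have "graph_components V {} = (\<lambda>x. {x}) ` V"
    by (auto simp: graph_components_eq_image)
  then show ?case by (simp add: card_image)
next
  case (insert e E)
  obtain u v where uv: "e = {u, v}" "u \<noteq> v" "u \<in> V" "v \<in> V"
    using insert.prems(2) by blast
  have "\<nexists>vs. is_cycle E vs"
    using insert.prems(1) by (auto simp: is_cycle_def)
  with insert have IH: "card E + card (graph_components V E) = card V" by blast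
  have "(u, v) \<notin> (adj_rel E)\<^sup>*"
    using acyclic_insert_not_connected insert.prems(1) insert.hyps(2) uv by metis
  with IH card_graph_components_insert[OF assms(2) uv(3,4)] insert.hyps uv(1)
  show ?case by simp
qed

section \<open>The entry sum of an alternating sign triangle\<close>

lemma finite_tri_index: "finite (tri_index n)"
  by (rule finite_subset[of _ "{1..n} \<times> {1..n}"]) (auto simp: tri_index_def)

lemma mem_tri_index: "(r, c) \<in> tri_index n \<longleftrightarrow> 1 \<le> int r \<and> 1 \<le> int c \<and> int r + int c \<le> int n + 1"
  by (auto simp: tri_index_def)

text \<open>The triangle at \<open>(r, c)\<close> is matched with its lowest vertex, which leaves the top row.\<close>

lemma grove_verts_eq:
  "grove_verts n = (\<lambda>(r, c). (2 * int c - 2 - int n + int r, - int r)) ` tri_index n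
     \<union> (\<lambda>k. (2 * int k - int n, 0)) ` {0..n}" (is "_ = ?f ` _ \<union> ?g ` _")
proof
  show "grove_verts n \<subseteq> ?f ` tri_index n \<union> ?g ` {0..n}"
  proof
    fix p assume "p \<in> grove_verts n"
    then obtain i j where p: "p = (i, j)" "\<bar>i\<bar> + \<bar>j\<bar> \<le> int n" "j \<le> 0" "(i + j) mod 2 = int n mod 2"
      by (auto simp: grove_verts_def)
    show "p \<in> ?f ` tri_index n \<union> ?g ` {0..n}"
    proof (cases "j = 0")
      case True
      with p have "p = ?g (nat ((i + int n) div 2))" "nat ((i + int n) div 2) \<in> {0..n}"
        by (auto, presburger+)
      then show ?thesis by blast
    next
      case False
      define r where "r = nat (- j)"
      define c where "c = nat ((i + 2 + int n + j) div 2)"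
      have r: "int r = - j" using p by (simp add: r_def)
      have "0 \<le> i + 2 + int n + j" using p(2) by linarith
      moreover have "even (i + 2 + int n + j)" using p(4) by presburger
      ultimately have c: "2 * int c = i + 2 + int n + j" by (simp add: c_def)
      have "p = ?f (r, c)" using p r c by simp
      moreover have "(r, c) \<in> tri_index n" unfolding mem_tri_index using p(2,3) r c False by linarith
      ultimately show ?thesis by blast
    qed
  qed
  show "?f ` tri_index n \<union> ?g ` {0..n} \<subseteq> grove_verts n"
    by (auto simp: grove_verts_def tri_index_def; presburger)
qed

lemma finite_grove_verts: "finite (grove_verts n)"
  by (simp add: grove_verts_eq finite_tri_index)

lemma card_grove_verts: "card (grove_verts n) = card (tri_index n) + (n + 1)"
proof -
  let ?f = "\<lambda>(r, c). (2 * int c - 2 - int n + int r, - int r)"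
  let ?g = "\<lambda>k. (2 * int k - int n, 0 :: int)"
  have "inj_on ?f (tri_index n)" "inj_on ?g {0..n}" "?f ` tri_index n \<inter> ?g ` {0..n} = {}"
    by (auto simp: inj_on_def tri_index_def)
  then show ?thesis
    unfolding grove_verts_eq by (simp add: card_Un_disjoint finite_tri_index card_image)
qed

lemma triangle_side_position:
  assumes "e \<in> triangle_sides n r c"
  shows "Max (snd ` e) = 1 - int r"
    and "\<bar>sum fst e - 2 * (2 * int c - 2 - int n + int r)\<bar> \<le> 1"
  using assms by (auto simp: triangle_sides_def Let_def)

lemma triangle_sides_disjoint:
  assumes "(r, c) \<noteq> (r', c')"
  shows "triangle_sides n r c \<inter> triangle_sides n r' c' = {}"
proof -
  have "r = r' \<and> c = c'" if e: "e \<in> triangle_sides n r c" "e \<in> triangle_sides n r' c'" for e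
    using triangle_side_position[OF e(1)] triangle_side_position[OF e(2)] by auto
  with assms show ?thesis by blast
qed

lemma lattice_edge_in_triangle:
  assumes "e \<in> lattice_edges n"
  obtains r c where "(r, c) \<in> tri_index n" "e \<in> triangle_sides n r c"
proof -
  obtain p q where pq: "e = {p, q}" "p \<in> grove_verts n" "q \<in> grove_verts n"
    "(fst q - fst p, snd q - snd p) \<in> {(2, 0), (-2, 0), (1, 1), (1, -1), (-1, 1), (-1, -1)}"
    using assms by (auto simp: lattice_edges_def)
  then have "\<exists>p q. e = {p, q} \<and> p \<in> grove_verts n \<and> q \<in> grove_verts n \<and>
      (fst q - fst p, snd q - snd p) \<in> {(2, 0), (1, 1), (-1, 1)}"
    (is "\<exists>p q. ?R p q")
  proof (cases "(fst q - fst p, snd q - snd p) \<in> {(2, 0), (1, 1), (-1, 1)}")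
    case False
    with pq have "?R q p" by auto
    then show ?thesis by blast
  qed blast
  then obtain p q where e: "e = {p, q}" and p: "p \<in> grove_verts n" and q: "q \<in> grove_verts n"
    and d: "(fst q - fst p, snd q - snd p) \<in> {(2, 0), (1, 1), (-1, 1)}"
    by blast
  obtain i j where ij: "p = (i, j)" by force
  define r where "r = nat (if snd q = j then 1 - j else - j)"
  define c where "c = nat ((i + 2 + int n + j) div 2)"
  have ij': "\<bar>i\<bar> + \<bar>j\<bar> \<le> int n" "j \<le> 0" "(i + j) mod 2 = int n mod 2"
    using p unfolding ij grove_verts_def by auto
  have "0 \<le> i + 2 + int n + j" using ij'(1) by linarith
  moreover have "even (i + 2 + int n + j)" using ij'(3) by presburger
  ultimately have c: "2 * int c = i + 2 + int n + j" by (simp add: c_def)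
  have r: "int r = (if snd q = j then 1 - j else - j)"
    using ij'(2) by (simp add: r_def)
  have "(r, c) \<in> tri_index n"
  proof (cases "snd q = j")
    case True
    then have "q = (i + 2, j)" using d ij by (cases q) auto
    then have "\<bar>i + 2\<bar> + \<bar>j\<bar> \<le> int n" using q by (auto simp: grove_verts_def)
    moreover have "int r = 1 - j" using r True by simp
    ultimately show ?thesis unfolding mem_tri_index using ij'(1,2) c by linarith
  next
    case False
    then have "snd q = j + 1" using d ij by auto
    then have "j < 0" using q by (cases q) (simp add: grove_verts_def)
    moreover have "int r = - j" using r False by simp
    ultimately show ?thesis unfolding mem_tri_index using ij'(1) c by linarith
  qed
  moreover have "e \<in> triangle_sides n r c"
  proof -
    have a: "2 * int c - 2 - int n + int r = (if snd q = j then i + 1 else i)"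
      using c r by (simp split: if_splits)
    from d ij consider "q = (i + 2, j)" | "q = (i + 1, j + 1)" | "q = (i - 1, j + 1)"
      by (cases q) auto
    then show ?thesis
      unfolding e ij triangle_sides_def Let_def a unfolding r
      by cases (simp_all add: insert_commute add.commute)
  qed
  ultimately show thesis by (rule that)
qed

lemma finite_triangle_sides: "finite (triangle_sides n r c)"
  by (simp add: triangle_sides_def Let_def)

lemma card_lattice_subgraph:
  assumes "E \<subseteq> lattice_edges n"
  shows "finite E"
    and "card E = (\<Sum>(r, c)\<in>tri_index n. card (triangle_sides n r c \<inter> E))"
proof -
  define T where "T p = triangle_sides n (fst p) (snd p) \<inter> E" for p
  have finite_T: "finite (T p)" for p
    by (simp add: T_def finite_triangle_sides)
  have E: "E = (\<Union>p\<in>tri_index n. T p)"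
  proof
    show "E \<subseteq> (\<Union>p\<in>tri_index n. T p)"
    proof
      fix e assume "e \<in> E"
      with assms have "e \<in> lattice_edges n" by blast
      then obtain r c where "(r, c) \<in> tri_index n" "e \<in> triangle_sides n r c"
        by (rule lattice_edge_in_triangle)
      with \<open>e \<in> E\<close> show "e \<in> (\<Union>p\<in>tri_index n. T p)"
        by (intro UN_I[of "(r, c)"]) (simp_all add: T_def)
    qed
  qed (auto simp: T_def)
  have "finite (\<Union>p\<in>tri_index n. T p)"
    using finite_T finite_tri_index by blast
  with E show "finite E" by simp
  have "T p \<inter> T q = {}" if "p \<noteq> q" for p q
    using triangle_sides_disjoint[of "fst p" "snd p" "fst q" "snd q" n] that
    unfolding T_def by (simp add: prod_eq_iff) blast
  then have "card (\<Union>p\<in>tri_index n. T p) = (\<Sum>p\<in>tri_index n. card (T p))"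
    using finite_T finite_tri_index by (intro card_UN_disjoint) auto
  with E show "card E = (\<Sum>(r, c)\<in>tri_index n. card (triangle_sides n r c \<inter> E))"
    by (simp add: case_prod_unfold T_def)
qed

text \<open>The corners are the degenerate pairs with \<open>k = 0\<close>.\<close>

lemma boundary_sets_eq:
  assumes "n \<ge> 1"
  shows "boundary_sets n =
    (\<lambda>k. {(- int n + 2 * int k, 0), (- int n + int k, - int k)}) ` {0..(n - 1) div 2} \<union>
    (\<lambda>k. {(int n - 2 * int k, 0), (int n - int k, - int k)}) ` {0..(n - 1) div 2} \<union>
    (\<lambda>k. {(- int k, - int n + int k), (int k, - int n + int k)}) ` {0..(n - 1) div 2} \<union>
    middle_triplet n" (is "_ = ?W ` ?K \<union> ?E ` ?K \<union> ?S ` ?K \<union> _")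
proof -
  have K: "?K = insert 0 {k. 0 < k \<and> 2 * k < n}"
    using assms by auto
  have I: "{i. 0 < i \<and> i < int n \<and> i mod 2 = int n mod 2} =
      (\<lambda>k. int n - 2 * int k) ` {k. 0 < k \<and> 2 * k < n}" (is "?I = _")
  proof (intro equalityI subsetI)
    fix i assume i: "i \<in> ?I"
    then have "even (int n - i)" by auto
    then obtain m where "int n - i = 2 * m" by (rule evenE)
    then have m: "i = int n - 2 * m" by simp
    with i show "i \<in> (\<lambda>k. int n - 2 * int k) ` {k. 0 < k \<and> 2 * k < n}"
      by (intro image_eqI[of _ _ "nat m"]) auto
  qed (auto, presburger)
  have "west_pairs n = (\<lambda>i. {(- i, 0), ((- int n - i) div 2, (- int n + i) div 2)}) ` ?I"
    by (auto simp: west_pairs_def)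
  also have "\<dots> = ?W ` {k. 0 < k \<and> 2 * k < n}"
    unfolding I image_image
  proof (intro image_cong refl)
    fix k
    have "(- int n - (int n - 2 * int k)) div 2 = - int n + int k"
      "(- int n + (int n - 2 * int k)) div 2 = - int k" by simp_all
    then show "{(- (int n - 2 * int k), 0),
        ((- int n - (int n - 2 * int k)) div 2, (- int n + (int n - 2 * int k)) div 2)} = ?W k"
      by simp
  qed
  finally have W: "west_pairs n = ?W ` {k. 0 < k \<and> 2 * k < n}" .
  have "east_pairs n = (\<lambda>i. {(i, 0), ((int n + i) div 2, (- int n + i) div 2)}) ` ?I"
    by (auto simp: east_pairs_def)
  also have "\<dots> = ?E ` {k. 0 < k \<and> 2 * k < n}"
    unfolding I image_image
  proof (intro image_cong refl)
    fix k
    have "(int n + (int n - 2 * int k)) div 2 = int n - int k"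
      "(- int n + (int n - 2 * int k)) div 2 = - int k" by simp_all
    then show "{(int n - 2 * int k, 0),
        ((int n + (int n - 2 * int k)) div 2, (- int n + (int n - 2 * int k)) div 2)} = ?E k"
      by simp
  qed
  finally have E: "east_pairs n = ?E ` {k. 0 < k \<and> 2 * k < n}" .
  have S: "south_pairs n = ?S ` {k. 0 < k \<and> 2 * k < n}"
  proof (intro equalityI subsetI)
    fix X assume "X \<in> south_pairs n"
    then obtain i where "X = {(- int n + i, - i), (int n - i, - i)}" "int n < 2 * i" "i < int n"
      by (auto simp: south_pairs_def)
    then show "X \<in> ?S ` {k. 0 < k \<and> 2 * k < n}"
      by (intro image_eqI[of _ _ "nat (int n - i)"]) auto
  next
    fix X assume "X \<in> ?S ` {k. 0 < k \<and> 2 * k < n}"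
    then obtain k where "X = ?S k" "0 < k" "2 * k < n" by auto
    then show "X \<in> south_pairs n"
      unfolding south_pairs_def
      by (intro CollectI exI[of _ "int n - int k"]) auto
  qed
  show ?thesis
    unfolding boundary_sets_def corner_sets_def W E S K by auto
qed

lemma card_boundary_sets:
  assumes "n \<ge> 1"
  shows "card (boundary_sets n) = (n + 1) div 2 + (n + 1)"
proof -
  let ?W = "\<lambda>k. {(- int n + 2 * int k, 0), (- int n + int k, - int k)}"
  let ?E = "\<lambda>k. {(int n - 2 * int k, 0), (int n - int k, - int k)}"
  let ?S = "\<lambda>k. {(- int k, - int n + int k), (int k, - int n + int k)}"
  let ?K = "{0..(n - 1) div 2}"
  have K: "2 * k < n" if "k \<in> ?K" for k
    using that assms by auto
  have inj: "inj_on ?W ?K" "inj_on ?E ?K" "inj_on ?S ?K"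
    by (auto simp: inj_on_def doubleton_eq_iff)
  have "?W ` ?K \<inter> ?E ` ?K = {}" "(?W ` ?K \<union> ?E ` ?K) \<inter> ?S ` ?K = {}"
    using assms by (auto simp: doubleton_eq_iff dest!: K)
  moreover have "(0, 0) \<notin> X" if "X \<in> ?W ` ?K \<union> ?E ` ?K \<union> ?S ` ?K" for X
    using that assms by (auto dest!: K)
  then have "(?W ` ?K \<union> ?E ` ?K \<union> ?S ` ?K) \<inter> middle_triplet n = {}"
    unfolding middle_triplet_def by (auto split: if_splits)
  moreover have "card (middle_triplet n) = (if even n then 1 else 0)" "finite (middle_triplet n)"
    by (auto simp: middle_triplet_def)
  ultimately have "card (boundary_sets n) = 3 * Suc ((n - 1) div 2) + (if even n then 1 else 0)"
    unfolding boundary_sets_eq[OF assms]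
    using inj by (simp add: card_Un_disjoint card_image)
  also have "\<dots> = (n + 1) div 2 + (n + 1)"
  proof (cases "even n")
    case True
    then obtain b where "n = 2 * b" by (rule evenE)
    moreover from this assms obtain k where "b = Suc k" by (cases b) auto
    ultimately show ?thesis by simp
  qed (auto elim!: oddE)
  finally show ?thesis .
qed

lemma card_graph_components_grove:
  assumes "simplified_grove n E" "n \<ge> 1"
  shows "card (graph_components (grove_verts n) E) = card (boundary_sets n)"
proof -
  let ?C = "graph_components (grove_verts n) E"
  have ex1: "\<And>C. C \<in> ?C \<Longrightarrow> \<exists>!S. S \<in> boundary_sets n \<and> S \<subseteq> C"
    and cover: "\<And>S. S \<in> boundary_sets n \<Longrightarrow> \<exists>C\<in>?C. S \<subseteq> C"
    using assms(1) by (auto simp: simplified_grove_def)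
  define f where "f C = (THE S. S \<in> boundary_sets n \<and> S \<subseteq> C)" for C
  have f: "f C \<in> boundary_sets n" "f C \<subseteq> C" if "C \<in> ?C" for C
    using theI'[OF ex1[OF that]] by (auto simp: f_def)
  have nonempty: "S \<noteq> {}" if "S \<in> boundary_sets n" for S
    using that by (auto simp: boundary_sets_eq[OF assms(2)] middle_triplet_def split: if_splits)
  have disjoint: "C = D" if "C \<in> ?C" "D \<in> ?C" "x \<in> C" "x \<in> D" for C D x
  proof -
    obtain u v where "C = {y \<in> grove_verts n. (u, y) \<in> (adj_rel E)\<^sup>*}"
      "D = {y \<in> grove_verts n. (v, y) \<in> (adj_rel E)\<^sup>*}"
      using \<open>C \<in> ?C\<close> \<open>D \<in> ?C\<close> unfolding graph_components_eq_image by blast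
    moreover from this have "(u, v) \<in> (adj_rel E)\<^sup>*" "(v, u) \<in> (adj_rel E)\<^sup>*"
      using \<open>x \<in> C\<close> \<open>x \<in> D\<close> adj_rel_rtrancl_sym[of x u E] adj_rel_rtrancl_sym[of x v E]
        rtrancl_trans[of u x _ v] rtrancl_trans[of v x _ u] by auto
    ultimately show ?thesis
      using rtrancl_trans[of u v "adj_rel E"] rtrancl_trans[of v u "adj_rel E"] by blast
  qed
  have "bij_betw f ?C (boundary_sets n)"
    unfolding bij_betw_def
  proof
    show "inj_on f ?C"
    proof (rule inj_onI)
      fix C D assume CD: "C \<in> ?C" "D \<in> ?C" "f C = f D"
      then obtain x where "x \<in> f C" using nonempty[OF f(1)[OF CD(1)]] by blast
      then have "x \<in> C" "x \<in> D" using f(2) CD by auto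
      with CD disjoint show "C = D" by blast
    qed
    show "f ` ?C = boundary_sets n"
    proof (intro equalityI subsetI)
      fix S assume S: "S \<in> boundary_sets n"
      then obtain C where C: "C \<in> ?C" "S \<subseteq> C" using cover by blast
      then have "f C = S" unfolding f_def using S by (intro the1_equality[OF ex1]) auto
      with C show "S \<in> f ` ?C" by blast
    qed (use f in blast)
  qed
  then show ?thesis by (rule bij_betw_same_card)
qed

lemma sum_grove_array:
  assumes "simplified_grove n E" "n \<ge> 1"
  shows "(\<Sum>(r, c)\<in>tri_index n. grove_array n E r c) = int ((n + 1) div 2)"
proof -
  have E: "E \<subseteq> lattice_edges n" "\<nexists>vs. is_cycle E vs"
    using assms by (auto simp: simplified_grove_def)
  have "card E + card (graph_components (grove_verts n) E) = card (grove_verts n)"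
  proof (rule card_forest)
    fix e assume "e \<in> E"
    then obtain p q where "e = {p, q}" "p \<in> grove_verts n" "q \<in> grove_verts n"
      "(fst q - fst p, snd q - snd p) \<in> {(2, 0), (-2, 0), (1, 1), (1, -1), (-1, 1), (-1, -1)}"
      using E(1) unfolding lattice_edges_def by blast
    then show "\<exists>u v. e = {u, v} \<and> u \<noteq> v \<and> u \<in> grove_verts n \<and> v \<in> grove_verts n"
      by (intro exI[of _ p] exI[of _ q]) auto
  qed (use E card_lattice_subgraph(1) finite_grove_verts in blast)+
  then have "int (card (tri_index n)) - int (card E) = int ((n + 1) div 2)"
    using card_graph_components_grove[OF assms] card_boundary_sets[OF assms(2)]
      card_grove_verts[of n] by simp
  moreover have "(\<Sum>(r, c)\<in>tri_index n. grove_array n E r c) =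
      (\<Sum>(r, c)\<in>tri_index n. 1 - int (card (triangle_sides n r c \<inter> E)))"
    by (intro sum.cong) (auto simp: grove_array_def)
  moreover have "\<dots> = int (card (tri_index n)) - int (card E)"
    by (simp add: card_lattice_subgraph(2)[OF E(1)] case_prod_unfold sum_subtractf)
  ultimately show ?thesis by simp
qed

lemma sum_identity_triangle:
  "(\<Sum>(r, c)\<in>tri_index n. identity_triangle n r c) = int ((n + 1) div 2)"
proof -
  have "(\<Sum>(r, c)\<in>tri_index n. identity_triangle n r c) =
      (\<Sum>p\<in>tri_index n. if p \<in> (\<lambda>r. (r, r)) ` {1..(n + 1) div 2} then 1 else 0)"
    by (intro sum.cong) (auto simp: identity_triangle_def tri_index_def)
  also have "\<dots> = int (card (tri_index n \<inter> (\<lambda>r. (r, r)) ` {1..(n + 1) div 2}))"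
    by (simp add: sum.inter_restrict[symmetric] finite_tri_index)
  also have "tri_index n \<inter> (\<lambda>r. (r, r)) ` {1..(n + 1) div 2} = (\<lambda>r. (r, r)) ` {1..(n + 1) div 2}"
    by (auto simp: tri_index_def)
  finally show ?thesis by (simp add: card_image inj_on_def)
qed

section \<open>Arrays generated by the patterns\<close>

definition pattern_shift :: "nat \<Rightarrow> tri_array \<Rightarrow> bool" where
  "pattern_shift n F \<longleftrightarrow> (\<forall>A. (pattern_step n)\<^sup>*\<^sup>* A (\<lambda>r c. A r c + F r c))"

definition unit_array :: "nat \<times> nat \<Rightarrow> tri_array" where
  "unit_array p = (\<lambda>r c. if (r, c) = p then 1 else 0)"

lemma pattern_shift_zero: "pattern_shift n (\<lambda>r c. 0)"
  by (simp add: pattern_shift_def)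

lemma pattern_shift_add:
  assumes "pattern_shift n F" "pattern_shift n G"
  shows "pattern_shift n (\<lambda>r c. F r c + G r c)"
  unfolding pattern_shift_def
proof
  fix A
  have "(pattern_step n)\<^sup>*\<^sup>* A (\<lambda>r c. A r c + F r c)"
    using assms(1) by (simp add: pattern_shift_def)
  also have "(pattern_step n)\<^sup>*\<^sup>* (\<lambda>r c. A r c + F r c) (\<lambda>r c. (A r c + F r c) + G r c)"
    using assms(2) unfolding pattern_shift_def by (rule spec)
  finally show "(pattern_step n)\<^sup>*\<^sup>* A (\<lambda>r c. A r c + (F r c + G r c))"
    by (simp add: add.assoc)
qed

lemma pattern_shift_sum:
  assumes "finite S" "\<And>p. p \<in> S \<Longrightarrow> pattern_shift n (F p)"
  shows "pattern_shift n (\<lambda>r c. \<Sum>p\<in>S. F p r c)"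
  using assms by (induction S rule: finite_induct) (auto intro: pattern_shift_zero pattern_shift_add)

lemma pattern_shift_nat_mult:
  assumes "pattern_shift n F"
  shows "pattern_shift n (\<lambda>r c. int k * F r c)"
  using pattern_shift_sum[of "{..<k}" n "\<lambda>_. F"] assms by simp

lemma pattern_shift_int_mult:
  assumes "pattern_shift n F" "pattern_shift n (\<lambda>r c. - F r c)"
  shows "pattern_shift n (\<lambda>r c. k * F r c)"
proof (cases "k \<ge> 0")
  case True
  then show ?thesis using pattern_shift_nat_mult[OF assms(1), of "nat k"] by simp
next
  case False
  then show ?thesis using pattern_shift_nat_mult[OF assms(2), of "nat (- k)"] by simp
qed

lemma pattern_shift_neighbours:
  assumes "1 \<le> r" "1 \<le> c" "c \<le> n - r"
    and "p \<in> {(r, c), (r, c + 1), (r + 1, c)}" "q \<in> {(r, c), (r, c + 1), (r + 1, c)}"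
  shows "pattern_shift n (\<lambda>r' c'. unit_array p r' c' - unit_array q r' c')"
proof -
  have pat: "pattern_shift n P" if "P \<in> {pattern1 r c, pattern2 r c, pattern3 r c}" for P
  proof -
    have "r \<le> n - 1" using assms(2,3) by linarith
    then show ?thesis
      unfolding pattern_shift_def pattern_step_def
      using assms(1-3) that by (intro allI r_into_rtranclp) blast
  qed
  let ?d = "\<lambda>p q r' c'. unit_array p r' c' - unit_array q r' c'"
  have "pattern1 r c = ?d (r, c + 1) (r, c)" "pattern2 r c = ?d (r, c) (r + 1, c)"
    "pattern3 r c = ?d (r + 1, c) (r, c + 1)"
    by (auto simp: pattern1_def pattern2_def pattern3_def sub_triangle_def unit_array_def fun_eq_iff)
  then have step: "pattern_shift n (?d (r, c + 1) (r, c))" "pattern_shift n (?d (r, c) (r + 1, c))"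
    "pattern_shift n (?d (r + 1, c) (r, c + 1))"
    using pat by auto
  have "pattern_shift n (?d (r, c) (r, c + 1))" "pattern_shift n (?d (r + 1, c) (r, c))"
    "pattern_shift n (?d (r, c + 1) (r + 1, c))"
    using pattern_shift_add[OF step(2) step(3)] pattern_shift_add[OF step(3) step(1)]
      pattern_shift_add[OF step(1) step(2)] by simp_all
  with step assms(4,5) pattern_shift_zero show ?thesis by auto
qed

lemma pattern_shift_unit_diff:
  assumes "(r, c) \<in> tri_index n"
  shows "pattern_shift n (\<lambda>r' c'. unit_array (r, c) r' c' - unit_array (1, 1) r' c')"
    and "pattern_shift n (\<lambda>r' c'. unit_array (1, 1) r' c' - unit_array (r, c) r' c')"
proof -
  let ?d = "\<lambda>p q r' c'. unit_array p r' c' - unit_array q r' c'"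
  let ?P = "\<lambda>p. pattern_shift n (?d p (1, 1)) \<and> pattern_shift n (?d (1, 1) p)"
  have trans: "?P p" if "?P q" "pattern_shift n (?d p q)" "pattern_shift n (?d q p)" for p q
    using pattern_shift_add[of n "?d p q" "?d q (1, 1)"]
      pattern_shift_add[of n "?d (1, 1) q" "?d q p"] that by simp
  have column: "?P (r, 1)" if "1 \<le> r" "r \<le> n" for r
    using that
  proof (induction r rule: dec_induct)
    case base
    show ?case using pattern_shift_zero by simp
  next
    case (step r)
    then have IH: "?P (r, 1)" by simp
    show ?case
      by (rule trans[OF IH]; rule pattern_shift_neighbours[of r 1]) (use step in auto)
  qed
  have "?P (r, c)" if "1 \<le> c" "c \<le> n + 1 - r" for c
    using that
  proof (induction c rule: dec_induct)
    case base
    show ?case using column assms by (simp add: tri_index_def)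
  next
    case (step c)
    then have IH: "?P (r, c)" by simp
    show ?case
      by (rule trans[OF IH]; rule pattern_shift_neighbours[of r c])
        (use step assms in \<open>auto simp: tri_index_def\<close>)
  qed
  then show "pattern_shift n (?d (r, c) (1, 1))" "pattern_shift n (?d (1, 1) (r, c))"
    using assms by (auto simp: tri_index_def)
qed

lemma pattern_shift_if_sum_zero:
  assumes "\<And>r c. (r, c) \<notin> tri_index n \<Longrightarrow> F r c = 0"
    and "(\<Sum>(r, c)\<in>tri_index n. F r c) = 0"
  shows "pattern_shift n F"
proof -
  let ?G = "\<lambda>p r c. F (fst p) (snd p) * (unit_array p r c - unit_array (1, 1) r c)"
  have "pattern_shift n (\<lambda>r c. \<Sum>p\<in>tri_index n. ?G p r c)"
    using pattern_shift_unit_diff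
    by (intro pattern_shift_sum pattern_shift_int_mult finite_tri_index) auto
  moreover have "(\<Sum>p\<in>tri_index n. ?G p r c) = F r c" for r c
  proof -
    have "(\<Sum>p\<in>tri_index n. ?G p r c) = (\<Sum>p\<in>tri_index n. F (fst p) (snd p) * unit_array p r c)
        - (\<Sum>p\<in>tri_index n. F (fst p) (snd p)) * unit_array (1, 1) r c"
      by (simp add: right_diff_distrib sum_subtractf sum_distrib_right)
    also have "(\<Sum>p\<in>tri_index n. F (fst p) (snd p)) = 0"
      using assms(2) by (simp add: case_prod_unfold)
    also have "(\<Sum>p\<in>tri_index n. F (fst p) (snd p) * unit_array p r c) =
        (\<Sum>p\<in>tri_index n. if (r, c) = p then F r c else 0)"
      by (intro sum.cong) (auto simp: unit_array_def)
    also have "\<dots> = F r c"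
      using assms(1) by (simp add: finite_tri_index)
    finally show ?thesis by simp
  qed
  ultimately show ?thesis by simp
qed

theorem theorem5:
  fixes n :: nat and A :: tri_array
  assumes "n \<ge> 1"
    and "alternating_sign_triangle n A"
  shows "(pattern_step n)\<^sup>*\<^sup>* A (identity_triangle n)"
proof -
  obtain E where E: "simplified_grove n E" "A = grove_array n E"
    using assms(2) by (auto simp: alternating_sign_triangle_def)
  have "pattern_shift n (\<lambda>r c. identity_triangle n r c - A r c)"
  proof (rule pattern_shift_if_sum_zero)
    show "(\<Sum>(r, c)\<in>tri_index n. identity_triangle n r c - A r c) = 0"
      using sum_grove_array[OF E(1) assms(1)] sum_identity_triangle[of n] E(2)
      by (simp add: case_prod_unfold sum_subtractf)
  qed (simp add: E(2) grove_array_def identity_triangle_def)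
  then have "(pattern_step n)\<^sup>*\<^sup>* A (\<lambda>r c. A r c + (identity_triangle n r c - A r c))"
    unfolding pattern_shift_def by (rule spec)
  then show ?thesis by simp
qed

end
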